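(* $$|F(x)|\ge\frac{1}{2+2\sqrt\pi\,x}\quad\text{for } x\ge0,\qquad\text{and}\qquad|F(x)|\ge\frac12\quad\text{for } x\le0.$$
   Context: The Fresnel integral is $F(x):=\frac{e^{-i\pi/4}}{\sqrt\pi}\int_x^\infty e^{it^2}\,dt$ for $x\in\mathbb{R}$ (improper integral). *)

theory Defs
  imports "HOL-Analysis.Analysis"
begin

text \<open>The integrand is not absolutely integrable on \<open>[x, \<infinity>)\<close>, so the improper integral is the
  limit of the integrals over \<open>[x, R]\<close> as \<open>R \<rightarrow> \<infinity>\<close>; it exists for every real \<open>x\<close>.\<close>

definition fresnel :: "real \<Rightarrow> complex" where
  "fresnel x = exp (- \<i> * of_real pi / 4) / of_real (sqrt pi) *
     Lim at_top (\<lambda>R::real. integral {x..R} (\<lambda>t. exp (\<i> * of_real (t\<^sup>2))))"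

end

theory Submission
  imports Defs "HOL-Probability.Distributions" "HOL-Real_Asymp.Real_Asymp"
begin

text \<open>
  Put \<open>G x = \<integral>\<^sub>x\<^sup>\<infinity> e\<^bsup>i t\<^sup>2\<^esup> dt\<close> for the tail integral, so that \<open>|F x| = |G x| / sqrt \<pi>\<close>. Rotating the
  path of integration suggests, for \<open>x \<ge> 0\<close>, the representation \<open>G x = e\<^bsup>i x\<^sup>2\<^esup> (a x + i b x)\<close> with
  \<open>a x = 1 / sqrt \<pi> * \<integral>\<^sub>0\<^sup>\<infinity> u\<^sup>2 e\<^bsup>- x\<^sup>2 u\<^sup>2\<^esup> / (1 + u\<^sup>4) du\<close> and
  \<open>b x = 1 / sqrt \<pi> * \<integral>\<^sub>0\<^sup>\<infinity> e\<^bsup>- x\<^sup>2 u\<^sup>2\<^esup> / (1 + u\<^sup>4) du\<close>,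
  in which both components are visibly nonnegative. To verify it, differentiate
  under the integral sign: \<open>a' = 2 x b - 1\<close> and \<open>b' = - 2 x a\<close>, so the right-hand side has
  derivative \<open>- e\<^bsup>i x\<^sup>2\<^esup>\<close>; as it tends to \<open>0\<close> at infinity, it is the tail integral, and the
  improper integral converges along the way (\<open>integral_exp_i_square\<close>, \<open>fresnel_eq_tail\<close>).

  The two differential equations yield \<open>(a\<^sup>2 + b\<^sup>2)' = - 2 a \<le> 0\<close>, so \<open>|G|\<close> decreases on \<open>[0, \<infinity>)\<close>
  from \<open>|G 0| = sqrt \<pi> / 2\<close>. For \<open>x \<le> 0\<close> this is enough, because \<open>G x = 2 G 0 - G (- x)\<close> and the
  triangle inequality give \<open>|G x| \<ge> |G 0|\<close>.

  For \<open>x \<ge> 0\<close> the claim is \<open>|G x| \<ge> 1 / (2 x + 2 / sqrt \<pi>)\<close>, which is an equality at \<open>0\<close> and has the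
  correct leading term at infinity, so the two ends are treated separately. Away from \<open>0\<close> one has
  \<open>|G| \<ge> b\<close>, and comparing \<open>1 / (1 + u\<^sup>4)\<close> with an affine function of \<open>u\<^sup>4\<close> under the Gaussian gives
  \<open>b x \<ge> 1 / (2 x + 3 / (2 x\<^sup>3))\<close>, which suffices as soon as \<open>sqrt \<pi> x \<ge> 39 / 20\<close>. Near \<open>0\<close>, starting
  from \<open>a, b \<ge> 0\<close> and integrating the differential equations repeatedly encloses \<open>a\<close> and \<open>b\<close>
  between polynomials and produces a polynomial of degree 6 below \<open>|G|\<^sup>2\<close>
  (\<open>norm_fresnel_tail_square_lower_poly\<close>). On \<open>[0, 39 / 20]\<close>, in the variable \<open>t = sqrt \<pi> x\<close>, the
  comparison of that polynomial with \<open>\<pi> / (2 + 2 t)\<^sup>2\<close> is a polynomial inequality certified by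
  nonnegative Bernstein coefficients.
\<close>

section \<open>Gaussian moments and two rational integrals\<close>

lemma has_bochner_integral_gaussian_even_moment:
  fixes x :: real
  assumes "x > 0"
  shows "has_bochner_integral lborel (\<lambda>u. u ^ (2 * k) * exp (- (x * u)\<^sup>2))
           (sqrt pi * (fact (2 * k) / (2 ^ (2 * k) * fact k)) / x ^ (2 * k + 1))"
proof -
  have "has_bochner_integral lborel (\<lambda>v. exp (- v\<^sup>2) * v ^ (2 * k))
          (sqrt pi * (fact (2 * k) / (2 ^ (2 * k) * fact k)))"
    using has_bochner_integral_even_function[OF gaussian_moment_even_pos[where k=k]] by simp
  then have "has_bochner_integral lborel (\<lambda>u. exp (- (x * u)\<^sup>2) * (x * u) ^ (2 * k))
          (sqrt pi * (fact (2 * k) / (2 ^ (2 * k) * fact k)) / x)"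
    using assms lborel_has_bochner_integral_real_affine_iff[of x "\<lambda>v. exp (- v\<^sup>2) * v ^ (2 * k)" _ 0]
    by (simp add: field_simps)
  from has_bochner_integral_mult_right[OF this, of "1 / x ^ (2 * k)"] show ?thesis
    using assms by (simp add: field_simps power_mult_distrib)
qed

text \<open>These are the initial values at \<open>x = 0\<close>. One family of antiderivatives, indexed by \<open>c\<close>, serves both
  integrands: \<open>c = 1\<close> gives numerator \<open>1\<close> and \<open>c = - 1\<close> gives numerator \<open>u\<^sup>2\<close>. Its logarithmic part
  cancels at both ends, so the value does not depend on \<open>c\<close>.\<close>

lemma integrals_rational_quartic:
  shows "integrable lborel (\<lambda>u::real. 1 / (1 + u ^ 4))" "(LINT u|lborel. 1 / (1 + u ^ 4)) = pi / sqrt (2::real)"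
    and "integrable lborel (\<lambda>u::real. u\<^sup>2 / (1 + u ^ 4))" "(LINT u|lborel. u\<^sup>2 / (1 + u ^ 4)) = pi / sqrt (2::real)"
proof -
  define s where "s = sqrt (2::real)"
  have s: "s > 0" "s\<^sup>2 = 2" by (auto simp: s_def)
  \<comment> \<open>\<open>1 + u\<^sup>4\<close> factors over the reals as \<open>q u * q (- u)\<close>.\<close>
  define q where "q = (\<lambda>u::real. u\<^sup>2 + s * u + 1)"
  define F where "F c u = (arctan (s * u + 1) + arctan (s * u - 1)) / (2 * s)
     + c * (ln (q u) - ln (q (-u))) / (4 * s)" for c u :: real
  have q: "q u > 0" for u
  proof -
    have "q u = (u + s / 2)\<^sup>2 + 1 / 2"
      using s(2) by (simp add: q_def power2_sum power_divide)
    then show ?thesis by (simp add: add_nonneg_pos)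
  qed
  have quartic: "1 + u ^ 4 = q u * q (-u)" for u
  proof -
    have "q u * q (-u) = (u\<^sup>2 + 1)\<^sup>2 - s\<^sup>2 * u\<^sup>2"
      by (simp add: q_def algebra_simps power2_eq_square)
    then show ?thesis unfolding s(2) by (simp add: power2_sum)
  qed
  have pos: "1 + u ^ 4 > 0" for u :: real by (simp add: add_pos_nonneg)
  have dF: "DERIV (F c) u :> (1 + c + (1 - c) * u\<^sup>2) / 2 / (1 + u ^ 4)" for c u
  proof -
    have e1: "1 + (s * u + 1)\<^sup>2 = 2 * q u"
      using s(2) by (simp add: q_def power2_sum power_mult_distrib)
    have e2: "1 + (s * u - 1)\<^sup>2 = 2 * q (- u)"
      using s(2) by (simp add: q_def power2_diff power_mult_distrib)
    have q1: "DERIV (\<lambda>u. q u) u :> 2 * u + s" "DERIV (\<lambda>u. q (- u)) u :> 2 * u - s"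
      unfolding q_def by (auto intro!: derivative_eq_intros)
    have a1: "DERIV (\<lambda>u. arctan (s * u + 1)) u :> s / (2 * q u)"
      unfolding e1[symmetric] by (auto intro!: derivative_eq_intros simp: field_simps)
    have a2: "DERIV (\<lambda>u. arctan (s * u - 1)) u :> s / (2 * q (-u))"
      unfolding e2[symmetric] by (auto intro!: derivative_eq_intros simp: field_simps)
    have b1: "DERIV (\<lambda>u. ln (q u)) u :> (2 * u + s) / q u"
      using DERIV_chain2[OF DERIV_ln[OF q] q1(1)] by (simp add: field_simps)
    have b2: "DERIV (\<lambda>u. ln (q (-u))) u :> (2 * u - s) / q (-u)"
      using DERIV_chain2[OF DERIV_ln[OF q] q1(2)] by (simp add: field_simps)
    have "DERIV (F c) u :> (s / (2 * q u) + s / (2 * q (-u))) / (2 * s)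
        + c * ((2 * u + s) / q u - (2 * u - s) / q (-u)) / (4 * s)"
      unfolding F_def
      by (intro DERIV_add DERIV_cdivide DERIV_cmult DERIV_diff a1 a2 b1 b2)
    also have "(s / (2 * q u) + s / (2 * q (-u))) / (2 * s)
        + c * ((2 * u + s) / q u - (2 * u - s) / q (-u)) / (4 * s)
        = (1 + c + (1 - c) * u\<^sup>2) / 2 / (1 + u ^ 4)"
    proof -
      have "(2 * u + s) / q u - (2 * u - s) / q (-u) = 2 * s * (1 - u\<^sup>2) / (1 + u ^ 4)"
        unfolding quartic using q[of u] q[of "-u"]
        by (simp add: divide_simps) (simp add: q_def algebra_simps power2_eq_square)
      moreover have "s / (2 * q u) + s / (2 * q (-u)) = s * (1 + u\<^sup>2) / (1 + u ^ 4)"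
        unfolding quartic using q[of u] q[of "-u"]
        by (simp add: divide_simps) (simp add: q_def algebra_simps power2_eq_square)
      ultimately show ?thesis using s(1) pos[of u]
        by (simp only:) (simp add: divide_simps, simp add: algebra_simps)
    qed
    finally show ?thesis .
  qed
  have lim1: "(F c \<longlongrightarrow> pi / (2 * s)) at_top" and lim2: "(F c \<longlongrightarrow> - pi / (2 * s)) at_bot" for c
  proof -
    have l1: "((\<lambda>u. arctan (s * u + 1)) \<longlongrightarrow> pi / 2) at_top" "((\<lambda>u. arctan (s * u - 1)) \<longlongrightarrow> pi / 2) at_top"
      "((\<lambda>u. arctan (s * u + 1)) \<longlongrightarrow> -(pi / 2)) at_bot" "((\<lambda>u. arctan (s * u - 1)) \<longlongrightarrow> - (pi / 2)) at_bot"
      "((\<lambda>u. ln (u\<^sup>2 + s * u + 1) - ln (u\<^sup>2 - s * u + 1)) \<longlongrightarrow> 0) at_top"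
      "((\<lambda>u. ln (u\<^sup>2 + s * u + 1) - ln (u\<^sup>2 - s * u + 1)) \<longlongrightarrow> 0) at_bot"
      using s(1) by real_asymp+
    have l: "((\<lambda>u. ln (q u) - ln (q (-u))) \<longlongrightarrow> 0) at_top" "((\<lambda>u. ln (q u) - ln (q (-u))) \<longlongrightarrow> 0) at_bot"
      using l1(5,6) by (simp_all add: q_def)
    have "(F c \<longlongrightarrow> (pi / 2 + pi / 2) / (2 * s) + c * 0 / (4 * s)) at_top"
      unfolding F_def using s(1) by (intro tendsto_intros l1 l) auto
    then show "(F c \<longlongrightarrow> pi / (2 * s)) at_top" by simp
    have "(F c \<longlongrightarrow> (- (pi / 2) + - (pi / 2)) / (2 * s) + c * 0 / (4 * s)) at_bot"
      unfolding F_def using s(1) by (intro tendsto_intros l1 l) auto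
    then show "(F c \<longlongrightarrow> - pi / (2 * s)) at_bot" by simp
  qed
  have main: "integrable lborel (\<lambda>u. (1 + c + (1 - c) * u\<^sup>2) / 2 / (1 + u ^ 4)) \<and>
     (LINT u|lborel. (1 + c + (1 - c) * u\<^sup>2) / 2 / (1 + u ^ 4)) = pi / s" if c: "\<bar>c\<bar> \<le> 1" for c
  proof -
    let ?f = "\<lambda>u. (1 + c + (1 - c) * u\<^sup>2) / 2 / (1 + u ^ 4)"
    have cont: "isCont ?f u" for u
      using pos[of u] by (intro continuous_intros) auto
    have nn: "0 \<le> ?f u" for u using c pos[of u] by simp
    note ftc = interval_integral_FTC_nonneg[of "-\<infinity>" \<infinity> "F c" ?f "- pi / (2 * s)" "pi / (2 * s)"]
    have "set_integrable lborel (einterval (-\<infinity>) \<infinity>) ?f"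
      using cont nn dF lim1 lim2 by (intro ftc) (auto simp: ereal_tendsto_simps1)
    moreover have "(LBINT u=-\<infinity>..\<infinity>. ?f u) = pi / (2 * s) - (- pi / (2 * s))"
      using cont nn dF lim1 lim2 by (intro ftc) (auto simp: ereal_tendsto_simps1)
    ultimately show ?thesis
      using s(1) by (simp add: interval_lebesgue_integral_def set_integrable_def set_lebesgue_integral_def
          einterval_eq field_simps)
  qed
  show "integrable lborel (\<lambda>u::real. 1 / (1 + u ^ 4))" "(LINT u|lborel. 1 / (1 + u ^ 4)) = pi / sqrt (2::real)"
    using main[of 1] by (simp_all add: s_def)
  show "integrable lborel (\<lambda>u::real. u\<^sup>2 / (1 + u ^ 4))" "(LINT u|lborel. u\<^sup>2 / (1 + u ^ 4)) = pi / sqrt (2::real)"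
    using main[of "-1"] by (simp_all add: s_def)
qed

section \<open>The Gaussian transform of \<open>u\<^sup>n / (1 + u\<^sup>4)\<close>\<close>

text \<open>Only even \<open>n\<close> occur, so integrating over the whole line just doubles the half-line integral and
  avoids indicator functions.\<close>

definition gauss_quartic :: "nat \<Rightarrow> real \<Rightarrow> real" where
  "gauss_quartic n x = (LINT u|lborel. u ^ n / (1 + u ^ 4) * exp (- (x * u)\<^sup>2))"

lemma quartic_pos: "0 < 1 + (u::real) ^ 4"
  by (simp add: add_pos_nonneg)

lemma quartic_weight_bounds:
  assumes "n \<in> {0, 2, 4}"
  shows "0 \<le> (u::real) ^ n / (1 + u ^ 4)" "(u::real) ^ n / (1 + u ^ 4) \<le> 1"
proof -
  have "0 \<le> (1 - u\<^sup>2)\<^sup>2" by simp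
  also have "\<dots> = 1 - 2 * u\<^sup>2 + u ^ 4" by (simp add: power2_diff)
  finally have "u\<^sup>2 \<le> 1 + u ^ 4" using zero_le_power2[of u] by linarith
  then show "u ^ n / (1 + u ^ 4) \<le> 1" "0 \<le> u ^ n / (1 + u ^ 4)"
    using assms quartic_pos[of u] by auto
qed

lemma integrable_quartic_weight:
  assumes "n \<in> {0, 2}"
  shows "integrable lborel (\<lambda>u::real. u ^ n / (1 + u ^ 4))"
  using assms integrals_rational_quartic by auto

lemma integrable_gauss: "x > 0 \<Longrightarrow> integrable lborel (\<lambda>u::real. exp (- (x * u)\<^sup>2))"
  using has_bochner_integral_gaussian_even_moment[of x 0] by (auto simp: has_bochner_integral_iff)

lemma norm_quartic_weight_times_exp_le:
  fixes u :: real
  assumes "n \<in> {0, 2, 4}"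
  shows "norm (u ^ n / (1 + u ^ 4) * exp (- (x * u)\<^sup>2)) \<le> u ^ n / (1 + u ^ 4)"
    and "norm (u ^ n / (1 + u ^ 4) * exp (- (x * u)\<^sup>2)) \<le> exp (- (x * u)\<^sup>2)"
proof -
  define w where "w = u ^ n / (1 + u ^ 4)"
  have "0 \<le> w" "w \<le> 1" using quartic_weight_bounds[OF assms] by (auto simp: w_def)
  then show "norm (w * exp (- (x * u)\<^sup>2)) \<le> w" "norm (w * exp (- (x * u)\<^sup>2)) \<le> exp (- (x * u)\<^sup>2)"
    by (auto simp: abs_mult intro: mult_left_le mult_left_le_one_le)
qed

lemma integrable_gauss_quartic:
  fixes x :: real
  assumes "n \<in> {0, 2} \<or> n = 4 \<and> x > 0"
  shows "integrable lborel (\<lambda>u. u ^ n / (1 + u ^ 4) * exp (- (x * u)\<^sup>2))"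
proof (cases "n \<in> {0, 2}")
  case True
  show ?thesis
  proof (rule Bochner_Integration.integrable_bound[OF integrable_quartic_weight[OF True]])
    show "AE u in lborel. norm (u ^ n / (1 + u ^ 4) * exp (- (x * u)\<^sup>2)) \<le> norm (u ^ n / (1 + u ^ 4))"
      using True by (intro AE_I2 order_trans[OF norm_quartic_weight_times_exp_le(1)]) auto
  qed measurable
next
  case False
  then have n: "n \<in> {0, 2, 4}" and x: "x > 0" using assms by auto
  show ?thesis
  proof (rule Bochner_Integration.integrable_bound[OF integrable_gauss[OF x]])
    show "AE u in lborel. norm (u ^ n / (1 + u ^ 4) * exp (- (x * u)\<^sup>2)) \<le> norm (exp (- (x * u)\<^sup>2))"
      using norm_quartic_weight_times_exp_le(2)[OF n] by (intro AE_I2) simp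
  qed measurable
qed

lemma gauss_quartic_nonneg: "n \<in> {0, 2, 4} \<Longrightarrow> 0 \<le> gauss_quartic n x"
  unfolding gauss_quartic_def
  by (intro integral_nonneg_AE AE_I2 mult_nonneg_nonneg quartic_weight_bounds) auto

lemma gauss_quartic_le:
  assumes "x > 0" "n \<in> {0, 2, 4}"
  shows "gauss_quartic n x \<le> sqrt pi / x"
proof -
  have "gauss_quartic n x \<le> (LINT u|lborel. exp (- (x * u)\<^sup>2))"
    unfolding gauss_quartic_def
  proof (intro integral_mono integrable_gauss_quartic integrable_gauss)
    fix u :: real
    show "u ^ n / (1 + u ^ 4) * exp (- (x * u)\<^sup>2) \<le> exp (- (x * u)\<^sup>2)"
      using quartic_weight_bounds[OF assms(2), of u] by (intro mult_left_le_one_le) auto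
  qed (use assms in auto)
  also have "\<dots> = sqrt pi / x"
    using has_bochner_integral_gaussian_even_moment[OF assms(1), of 0] by (auto simp: has_bochner_integral_iff)
  finally show ?thesis .
qed

text \<open>This relation closes the system of differential equations: the derivative of the transform with
  \<open>n = 2\<close> involves \<open>n = 4\<close>, which reduces to \<open>n = 0\<close>.\<close>

lemma gauss_quartic_0_add_4:
  assumes "x > 0"
  shows "gauss_quartic 0 x + gauss_quartic 4 x = sqrt pi / x"
proof -
  have "gauss_quartic 0 x + gauss_quartic 4 x
      = (LINT u|lborel. u ^ 0 / (1 + u ^ 4) * exp (- (x * u)\<^sup>2) + u ^ 4 / (1 + u ^ 4) * exp (- (x * u)\<^sup>2))"
    unfolding gauss_quartic_def
    using assms by (intro Bochner_Integration.integral_add[symmetric] integrable_gauss_quartic) auto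
  also have "\<dots> = (LINT u|lborel. exp (- (x * u)\<^sup>2))"
  proof (intro Bochner_Integration.integral_cong refl)
    fix u :: real
    show "u ^ 0 / (1 + u ^ 4) * exp (- (x * u)\<^sup>2) + u ^ 4 / (1 + u ^ 4) * exp (- (x * u)\<^sup>2) = exp (- (x * u)\<^sup>2)"
    proof -
      have "1 / (1 + u ^ 4) + u ^ 4 / (1 + u ^ 4) = 1"
        using quartic_pos[of u] by (simp add: add_divide_distrib[symmetric])
      then show ?thesis by (simp only: distrib_right[symmetric]) simp
    qed
  qed
  also have "\<dots> = sqrt pi / x"
    using has_bochner_integral_gaussian_even_moment[OF assms(1), of 0] by (auto simp: has_bochner_integral_iff)
  finally show ?thesis .
qed

text \<open>For every \<open>l\<close>, \<open>1 / (1 + w) \<ge> 2 l - l\<^sup>2 (1 + w)\<close>, since the difference is a square divided by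
  \<open>1 + w\<close>. With \<open>w = u\<^sup>4\<close> the right-hand side has an explicit Gaussian integral; the best \<open>l\<close> is the
  reciprocal of the Gaussian mean of \<open>1 + u\<^sup>4\<close>, which is \<open>1 + 3 / (4 x\<^sup>4)\<close>.\<close>

lemma gauss_quartic_0_lower:
  assumes "x > 0"
  shows "gauss_quartic 0 x \<ge> sqrt pi / (x + 3 / (4 * x ^ 3))"
proof -
  define l where "l = 1 / (1 + 3 / (4 * x ^ 4))"
  have m0: "has_bochner_integral lborel (\<lambda>u. exp (- (x * u)\<^sup>2)) (sqrt pi / x)"
    using has_bochner_integral_gaussian_even_moment[OF assms(1), of 0] by simp
  have m4: "has_bochner_integral lborel (\<lambda>u. u ^ 4 * exp (- (x * u)\<^sup>2)) (3 * sqrt pi / (4 * x ^ 5))"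
    using has_bochner_integral_gaussian_even_moment[OF assms(1), of 2]
    by (simp add: fact_numeral mult.commute)
  have p: "1 + 3 / (4 * x ^ 4) > 0" using assms by (simp add: add_pos_nonneg)
  have "sqrt pi / (x + 3 / (4 * x ^ 3)) = l * (sqrt pi / x)"
    using assms unfolding l_def by (simp add: field_simps power_numeral_reduce)
  also have "\<dots> = (2 * l - l\<^sup>2) * (sqrt pi / x) - l\<^sup>2 * (3 * sqrt pi / (4 * x ^ 5))"
  proof -
    have "3 * sqrt pi / (4 * x ^ 5) = (sqrt pi / x) * (1 / l - 1)"
      using assms p by (simp add: l_def field_simps power_numeral_reduce)
    moreover have "l \<noteq> 0" using p by (simp add: l_def)
    then have "l\<^sup>2 * (c * (1 / l - 1)) = (l - l\<^sup>2) * c" for c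
      by (simp add: field_simps power2_eq_square)
    ultimately have "l\<^sup>2 * (3 * sqrt pi / (4 * x ^ 5)) = (l - l\<^sup>2) * (sqrt pi / x)"
      by (simp add: mult.assoc)
    then show ?thesis by (simp only:) (simp add: algebra_simps)
  qed
  also have "\<dots> = (LINT u|lborel. (2 * l - l\<^sup>2) * exp (- (x * u)\<^sup>2) - l\<^sup>2 * (u ^ 4 * exp (- (x * u)\<^sup>2)))"
    by (rule has_bochner_integral_integral_eq[symmetric])
      (intro has_bochner_integral_diff has_bochner_integral_mult_right m0 m4)
  also have "\<dots> \<le> gauss_quartic 0 x"
    unfolding gauss_quartic_def
  proof (intro integral_mono integrable_gauss_quartic)
    show "integrable lborel (\<lambda>u. (2 * l - l\<^sup>2) * exp (- (x * u)\<^sup>2) - l\<^sup>2 * (u ^ 4 * exp (- (x * u)\<^sup>2)))"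
      using m0 m4 by (auto simp: has_bochner_integral_iff)
    fix u :: real
    have "0 \<le> (1 - l * (1 + u ^ 4))\<^sup>2 / (1 + u ^ 4)"
      using quartic_pos[of u] by simp
    also have "\<dots> = 1 / (1 + u ^ 4) - (2 * l - l\<^sup>2 * (1 + u ^ 4))"
      using quartic_pos[of u] by (simp add: field_simps power2_eq_square)
    finally have "(2 * l - l\<^sup>2 * (1 + u ^ 4)) * exp (- (x * u)\<^sup>2) \<le> 1 / (1 + u ^ 4) * exp (- (x * u)\<^sup>2)"
      by (intro mult_right_mono) auto
    then show "(2 * l - l\<^sup>2) * exp (- (x * u)\<^sup>2) - l\<^sup>2 * (u ^ 4 * exp (- (x * u)\<^sup>2))
        \<le> u ^ 0 / (1 + u ^ 4) * exp (- (x * u)\<^sup>2)"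
      by (simp add: algebra_simps)
  qed auto
  finally show ?thesis .
qed

text \<open>The weight itself is an integrable majorant for all \<open>x\<close> at once, so continuity includes the
  point \<open>0\<close>, where a Gaussian majorant is not available.\<close>

lemma isCont_gauss_quartic:
  assumes n: "n \<in> {0, 2}"
  shows "isCont (gauss_quartic n) x"
  unfolding continuous_at_sequentially
proof (intro allI impI)
  fix X :: "nat \<Rightarrow> real" assume X: "X \<longlonglongrightarrow> x"
  have "(\<lambda>i. LINT u|lborel. u ^ n / (1 + u ^ 4) * exp (- (X i * u)\<^sup>2)) \<longlonglongrightarrow>
      (LINT u|lborel. u ^ n / (1 + u ^ 4) * exp (- (x * u)\<^sup>2))"
  proof (rule integral_dominated_convergence[where w = "\<lambda>u. u ^ n / (1 + u ^ 4)"])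
    show "integrable lborel (\<lambda>u::real. u ^ n / (1 + u ^ 4))" by (rule integrable_quartic_weight[OF n])
    show "AE u in lborel. (\<lambda>i. u ^ n / (1 + u ^ 4) * exp (- (X i * u)\<^sup>2)) \<longlonglongrightarrow> u ^ n / (1 + u ^ 4) * exp (- (x * u)\<^sup>2)"
      by (intro AE_I2 tendsto_intros X)
    show "AE u in lborel. norm (u ^ n / (1 + u ^ 4) * exp (- (X i * u)\<^sup>2)) \<le> u ^ n / (1 + u ^ 4)" for i
      by (intro AE_I2 norm_quartic_weight_times_exp_le) (use n in auto)
  qed measurable
  then show "(gauss_quartic n \<circ> X) \<longlonglongrightarrow> gauss_quartic n x"
    by (simp add: gauss_quartic_def comp_def)
qed

text \<open>Domination of the difference quotients near \<open>x\<close>: the mean value theorem, with the interval kept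
  away from \<open>0\<close> so that a fixed Gaussian factor survives.\<close>

lemma exp_square_difference_bound:
  fixes x y u :: real
  assumes x: "x > 0" and y: "y \<in> {x / 2<..<2 * x}"
  shows "\<bar>exp (- (y * u)\<^sup>2) - exp (- (x * u)\<^sup>2)\<bar> \<le> 4 * x * u\<^sup>2 * exp (- (x / 2 * u)\<^sup>2) * \<bar>y - x\<bar>"
proof -
  have "norm (exp (- (y * u)\<^sup>2) - exp (- (x * u)\<^sup>2)) \<le> (4 * x * u\<^sup>2 * exp (- (x / 2 * u)\<^sup>2)) * norm (y - x)"
  proof (rule field_differentiable_bound[where S = "{x / 2<..<2 * x}"])
    fix z assume z: "z \<in> {x / 2<..<2 * x}"
    show "((\<lambda>z. exp (- (z * u)\<^sup>2)) has_field_derivative (- 2 * z * u\<^sup>2 * exp (- (z * u)\<^sup>2))) (at z within {x / 2<..<2 * x})"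
      by (auto intro!: derivative_eq_intros simp: power2_eq_square)
    have "(x / 2 * u)\<^sup>2 \<le> (z * u)\<^sup>2"
      using z x by (auto simp: power_mult_distrib intro!: mult_right_mono power_mono simp del: times_divide_eq_left)
    then have "2 * z * (u\<^sup>2 * exp (- (z * u)\<^sup>2)) \<le> 4 * x * (u\<^sup>2 * exp (- (x / 2 * u)\<^sup>2))"
      using z x by (intro mult_mono[of "2 * z" "4 * x"] mult_left_mono) auto
    then show "norm (- 2 * z * u\<^sup>2 * exp (- (z * u)\<^sup>2)) \<le> 4 * x * u\<^sup>2 * exp (- (x / 2 * u)\<^sup>2)"
      using z x by (simp add: abs_mult mult.assoc)
  qed (use x y in auto)
  then show ?thesis by simp
qed

text \<open>Dominated convergence along sequences. The factor \<open>u\<^sup>2\<close> produced by differentiation is absorbed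
  by the weight, since \<open>u\<^bsup>n + 2\<^esup> / (1 + u\<^sup>4) \<le> 1\<close>, which leaves a Gaussian as majorant.\<close>

lemma DERIV_gauss_quartic:
  assumes n: "n \<in> {0, 2}" and x: "x > 0"
  shows "DERIV (gauss_quartic n) x :> - 2 * x * gauss_quartic (n + 2) x"
proof -
  let ?S = "{x / 2<..<2 * x}"
  let ?q = "\<lambda>y u. u ^ n / (1 + u ^ 4) * ((exp (- (y * u)\<^sup>2) - exp (- (x * u)\<^sup>2)) / (y - x))"
  have "((\<lambda>y. (gauss_quartic n y - gauss_quartic n x) / (y - x)) \<longlongrightarrow> - 2 * x * gauss_quartic (n + 2) x) (at x within ?S)"
    unfolding tendsto_at_iff_sequentially
  proof (intro allI impI)
    fix X assume X: "\<forall>i. X i \<in> ?S - {x}" "X \<longlonglongrightarrow> x"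
    have "(\<lambda>i. LINT u|lborel. ?q (X i) u) \<longlonglongrightarrow> (LINT u|lborel. u ^ n / (1 + u ^ 4) * (- 2 * x * u\<^sup>2 * exp (- (x * u)\<^sup>2)))"
    proof (rule integral_dominated_convergence[where w = "\<lambda>u. 4 * x * exp (- (x / 2 * u)\<^sup>2)"])
      show "integrable lborel (\<lambda>u. 4 * x * exp (- (x / 2 * u)\<^sup>2))"
        using x by (intro integrable_mult_right integrable_gauss) auto
      show "AE u in lborel. (\<lambda>i. ?q (X i) u) \<longlonglongrightarrow> u ^ n / (1 + u ^ 4) * (- 2 * x * u\<^sup>2 * exp (- (x * u)\<^sup>2))"
      proof (rule AE_I2)
        fix u :: real
        have "DERIV (\<lambda>z. exp (- (z * u)\<^sup>2)) x :> - 2 * x * u\<^sup>2 * exp (- (x * u)\<^sup>2)"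
          by (auto intro!: derivative_eq_intros simp: power2_eq_square)
        then have "((\<lambda>y. (exp (- (y * u)\<^sup>2) - exp (- (x * u)\<^sup>2)) / (y - x)) \<longlongrightarrow> - 2 * x * u\<^sup>2 * exp (- (x * u)\<^sup>2)) (at x)"
          by (simp add: has_field_derivative_iff)
        then have "(\<lambda>i. (exp (- (X i * u)\<^sup>2) - exp (- (x * u)\<^sup>2)) / (X i - x)) \<longlonglongrightarrow> - 2 * x * u\<^sup>2 * exp (- (x * u)\<^sup>2)"
          using X unfolding tendsto_at_iff_sequentially comp_def by auto
        then show "(\<lambda>i. ?q (X i) u) \<longlonglongrightarrow> u ^ n / (1 + u ^ 4) * (- 2 * x * u\<^sup>2 * exp (- (x * u)\<^sup>2))"
          by (rule tendsto_mult_left)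
      qed
      show "AE u in lborel. norm (?q (X i) u) \<le> 4 * x * exp (- (x / 2 * u)\<^sup>2)" for i
      proof (rule AE_I2)
        fix u :: real
        have Xi: "X i \<in> ?S" "X i \<noteq> x" using X by auto
        have "n \<in> {0, 2, 4}" "n + 2 \<in> {0, 2, 4}" using n by auto
        then have w: "0 \<le> u ^ n / (1 + u ^ 4)" "u ^ n / (1 + u ^ 4) * u\<^sup>2 \<le> 1"
          using quartic_weight_bounds(1)[of n u] quartic_weight_bounds(2)[of "n + 2" u]
          by (simp_all only: power_add times_divide_eq_left)
        have "\<bar>(exp (- (X i * u)\<^sup>2) - exp (- (x * u)\<^sup>2)) / (X i - x)\<bar> \<le> 4 * x * u\<^sup>2 * exp (- (x / 2 * u)\<^sup>2)"
          using exp_square_difference_bound[OF x Xi(1), of u] Xi(2) by (simp add: abs_divide pos_divide_le_eq)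
        then have "norm (?q (X i) u) \<le> u ^ n / (1 + u ^ 4) * (4 * x * u\<^sup>2 * exp (- (x / 2 * u)\<^sup>2))"
          unfolding real_norm_def abs_mult abs_of_nonneg[OF w(1)] by (rule mult_left_mono) (rule w(1))
        also have "\<dots> = (u ^ n / (1 + u ^ 4) * u\<^sup>2) * (4 * x * exp (- (x / 2 * u)\<^sup>2))" by simp
        also have "\<dots> \<le> 1 * (4 * x * exp (- (x / 2 * u)\<^sup>2))"
          using x by (intro mult_right_mono w(2)) auto
        finally show "norm (?q (X i) u) \<le> 4 * x * exp (- (x / 2 * u)\<^sup>2)" by simp
      qed
    qed measurable
    also have "(LINT u|lborel. u ^ n / (1 + u ^ 4) * (- 2 * x * u\<^sup>2 * exp (- (x * u)\<^sup>2)))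
        = (LINT u|lborel. (- 2 * x) * (u ^ (n + 2) / (1 + u ^ 4) * exp (- (x * u)\<^sup>2)))"
      by (intro Bochner_Integration.integral_cong refl) (simp add: power_add power2_eq_square)
    also have "\<dots> = - 2 * x * gauss_quartic (n + 2) x"
      unfolding gauss_quartic_def by (rule integral_mult_right_zero)
    also have "(\<lambda>i. LINT u|lborel. ?q (X i) u) = (\<lambda>i. (gauss_quartic n (X i) - gauss_quartic n x) / (X i - x))"
    proof
      fix i
      let ?g = "\<lambda>y u. u ^ n / (1 + u ^ 4) * exp (- (y * u)\<^sup>2)"
      have int: "integrable lborel (?g y)" for y :: real
        by (intro integrable_gauss_quartic disjI1 n)
      have "gauss_quartic n (X i) - gauss_quartic n x = (LINT u|lborel. ?g (X i) u - ?g x u)"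
        unfolding gauss_quartic_def by (rule Bochner_Integration.integral_diff[OF int int, symmetric])
      then have "(gauss_quartic n (X i) - gauss_quartic n x) / (X i - x)
          = (LINT u|lborel. (?g (X i) u - ?g x u) / (X i - x))"
        by (simp only: integral_divide_zero)
      also have "\<dots> = (LINT u|lborel. ?q (X i) u)"
        by (simp only: right_diff_distrib times_divide_eq_right)
      finally show "(LINT u|lborel. ?q (X i) u) = (gauss_quartic n (X i) - gauss_quartic n x) / (X i - x)" ..
    qed
    finally show "((\<lambda>y. (gauss_quartic n y - gauss_quartic n x) / (y - x)) \<circ> X) \<longlonglongrightarrow> - 2 * x * gauss_quartic (n + 2) x"
      unfolding comp_def .
  qed
  moreover have "at x within ?S = at x"
    using x by (intro at_within_open) auto
  ultimately show ?thesis
    unfolding has_field_derivative_iff by (simp only:)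
qed

section \<open>The auxiliary functions and their differential equations\<close>

text \<open>The tool for integrating a differential inequality from \<open>0\<close>. Continuity replaces
  differentiability at \<open>0\<close>, since the differential equations below are established for positive \<open>x\<close>.\<close>

lemma le_of_DERIV_le:
  fixes f g :: "real \<Rightarrow> real"
  assumes "0 \<le> x" "f 0 \<le> g 0"
    and "\<And>y. isCont f y" "\<And>y. isCont g y"
    and "\<And>y. 0 < y \<Longrightarrow> DERIV f y :> f' y" "\<And>y. 0 < y \<Longrightarrow> DERIV g y :> g' y"
    and "\<And>y. 0 < y \<Longrightarrow> f' y \<le> g' y"
  shows "f x \<le> g x"
proof -
  have "g 0 - f 0 \<le> g x - f x"
  proof (rule DERIV_nonneg_imp_increasing_open[OF assms(1)])
    fix y :: real assume "0 < y" "y < x"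
    then show "\<exists>d. DERIV (\<lambda>y. g y - f y) y :> d \<and> d \<ge> 0"
      using assms(5-7) by (intro exI[of _ "g' y - f' y"] conjI DERIV_diff) auto
  qed (use assms(3,4) in \<open>auto intro!: continuous_at_imp_continuous_on continuous_diff\<close>)
  then show ?thesis using assms(2) by simp
qed

text \<open>The real and imaginary parts of \<open>e\<^bsup>- i x\<^sup>2\<^esup> \<integral>\<^sub>x\<^sup>\<infinity> e\<^bsup>i t\<^sup>2\<^esup> dt\<close> for \<open>x \<ge> 0\<close>; up to scaling, the
  classical auxiliary functions of the Fresnel integrals.\<close>

definition aux_re :: "real \<Rightarrow> real" where
  "aux_re x = gauss_quartic 2 x / (2 * sqrt pi)"

definition aux_im :: "real \<Rightarrow> real" where
  "aux_im x = gauss_quartic 0 x / (2 * sqrt pi)"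

lemma DERIV_aux_im: "x > 0 \<Longrightarrow> DERIV aux_im x :> - 2 * x * aux_re x"
  using DERIV_cdivide[OF DERIV_gauss_quartic[of 0 x], of "2 * sqrt pi"]
  unfolding aux_im_def[abs_def] aux_re_def by (simp add: eval_nat_numeral)

lemma DERIV_aux_re:
  assumes "x > 0"
  shows "DERIV aux_re x :> 2 * x * aux_im x - 1"
proof -
  have "gauss_quartic 4 x = sqrt pi / x - gauss_quartic 0 x"
    using gauss_quartic_0_add_4[OF assms] by simp
  then have "- 2 * x * gauss_quartic 4 x / (2 * sqrt pi) = 2 * x * aux_im x - 1"
    using assms by (simp add: aux_im_def field_simps)
  then show ?thesis
    using DERIV_cdivide[OF DERIV_gauss_quartic[of 2 x], of "2 * sqrt pi"] assms
    unfolding aux_re_def[abs_def] by simp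
qed

lemma isCont_aux: "isCont aux_re x" "isCont aux_im x"
  unfolding aux_re_def[abs_def] aux_im_def[abs_def]
  by (intro continuous_intros isCont_gauss_quartic; simp)+

lemma aux_at_0: "aux_re 0 = sqrt pi / (2 * sqrt 2)" "aux_im 0 = sqrt pi / (2 * sqrt 2)"
proof -
  have "pi / sqrt 2 / (2 * sqrt pi) = sqrt pi / (2 * sqrt 2)"
    by (simp add: field_simps)
  then show "aux_re 0 = sqrt pi / (2 * sqrt 2)" "aux_im 0 = sqrt pi / (2 * sqrt 2)"
    using integrals_rational_quartic by (simp_all add: aux_re_def aux_im_def gauss_quartic_def)
qed

lemma aux_nonneg: "0 \<le> aux_re x" "0 \<le> aux_im x"
  by (simp_all add: aux_re_def aux_im_def gauss_quartic_nonneg)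

lemma aux_le:
  assumes "x > 0"
  shows "aux_re x \<le> 1 / (2 * x)" "aux_im x \<le> 1 / (2 * x)"
  using gauss_quartic_le[OF assms, of 2] gauss_quartic_le[OF assms, of 0] assms
  by (simp_all add: aux_re_def aux_im_def field_simps)

lemma aux_im_lower:
  assumes "x > 0"
  shows "aux_im x \<ge> 1 / (2 * x + 3 / (2 * x ^ 3))"
proof -
  have p: "x + 3 / (4 * x ^ 3) > 0" using assms by (simp add: add_pos_pos)
  have "1 / (2 * x + 3 / (2 * x ^ 3)) = 1 / (2 * (x + 3 / (4 * x ^ 3)))" by simp
  also have "\<dots> = sqrt pi / (x + 3 / (4 * x ^ 3)) / (2 * sqrt pi)" by simp
  also have "\<dots> \<le> aux_im x"
    unfolding aux_im_def by (intro divide_right_mono gauss_quartic_0_lower assms) simp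
  finally show ?thesis .
qed

section \<open>The tail integral\<close>

text \<open>A closed form for the tail integral that is meant only for \<open>x \<ge> 0\<close>: the auxiliary functions
  are even, so for negative \<open>x\<close> the value is not the tail integral.\<close>

definition fresnel_tail :: "real \<Rightarrow> complex" where
  "fresnel_tail x = exp (\<i> * of_real (x\<^sup>2)) * Complex (aux_re x) (aux_im x)"

text \<open>Differentiating the factor \<open>e\<^bsup>i x\<^sup>2\<^esup>\<close> cancels all terms of the two differential equations except
  the inhomogeneous \<open>- 1\<close>.\<close>

lemma has_vector_derivative_fresnel_tail:
  assumes "x > 0"
  shows "(fresnel_tail has_vector_derivative - exp (\<i> * of_real (x\<^sup>2))) (at x)"
proof -
  have "((\<lambda>z. exp (\<i> * z\<^sup>2)) has_field_derivative (2 * \<i> * of_real x * exp (\<i> * (of_real x)\<^sup>2))) (at (of_real x))"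
    by (auto intro!: derivative_eq_intros)
  then have e: "((\<lambda>t. exp (\<i> * of_real (t\<^sup>2))) has_vector_derivative 2 * \<i> * of_real x * exp (\<i> * of_real (x\<^sup>2))) (at x)"
    using has_vector_derivative_real_field by fastforce
  have "(fresnel_tail has_vector_derivative
      exp (\<i> * of_real (x\<^sup>2)) * (of_real (2 * x * aux_im x - 1) + \<i> * of_real (- 2 * x * aux_re x))
      + 2 * \<i> * of_real x * exp (\<i> * of_real (x\<^sup>2)) * (of_real (aux_re x) + \<i> * of_real (aux_im x))) (at x)"
    unfolding fresnel_tail_def[abs_def] Complex_eq
    by (intro has_vector_derivative_mult e has_vector_derivative_add has_vector_derivative_mult_right
        has_vector_derivative_of_real DERIV_aux_re DERIV_aux_im assms)
  also have "exp (\<i> * of_real (x\<^sup>2)) * (of_real (2 * x * aux_im x - 1) + \<i> * of_real (- 2 * x * aux_re x))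
      + 2 * \<i> * of_real x * exp (\<i> * of_real (x\<^sup>2)) * (of_real (aux_re x) + \<i> * of_real (aux_im x))
      = - exp (\<i> * of_real (x\<^sup>2))"
    by (simp add: algebra_simps)
  finally show ?thesis .
qed

lemma isCont_fresnel_tail: "isCont fresnel_tail x"
  unfolding fresnel_tail_def[abs_def] Complex_eq
  by (intro continuous_intros isCont_aux)

lemma norm_fresnel_tail: "norm (fresnel_tail x) = sqrt ((aux_re x)\<^sup>2 + (aux_im x)\<^sup>2)"
  by (simp add: fresnel_tail_def norm_mult complex_norm flip: of_real_power)

lemma fresnel_tail_at_top: "(fresnel_tail \<longlongrightarrow> 0) at_top"
proof (rule Lim_null_comparison)
  show "\<forall>\<^sub>F x in at_top. norm (fresnel_tail x) \<le> 1 / (2 * x) + 1 / (2 * x)"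
    using eventually_gt_at_top[of 0]
  proof eventually_elim
    case (elim x)
    have "norm (fresnel_tail x) \<le> \<bar>aux_re x\<bar> + \<bar>aux_im x\<bar>"
      unfolding norm_fresnel_tail by (rule sqrt_sum_squares_le_sum_abs)
    then show ?case using aux_nonneg[of x] aux_le[OF elim] by simp
  qed
  show "((\<lambda>x::real. 1 / (2 * x) + 1 / (2 * x)) \<longlongrightarrow> 0) at_top" by real_asymp
qed

lemma integral_exp_i_square:
  assumes "0 \<le> x" "x \<le> R"
  shows "((\<lambda>t. exp (\<i> * of_real (t\<^sup>2))) has_integral (fresnel_tail x - fresnel_tail R)) {x..R}"
proof -
  have "((\<lambda>t. - exp (\<i> * of_real (t\<^sup>2))) has_integral (fresnel_tail R - fresnel_tail x)) {x..R}"
    using assms by (intro fundamental_theorem_of_calculus_interior has_vector_derivative_fresnel_tail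
        continuous_at_imp_continuous_on ballI isCont_fresnel_tail) auto
  from has_integral_neg[OF this] show ?thesis by simp
qed

lemma fresnel_eq_tail:
  assumes "0 \<le> x"
  shows "fresnel x = exp (- \<i> * of_real pi / 4) / of_real (sqrt pi) * fresnel_tail x"
proof -
  have "((\<lambda>R. integral {x..R} (\<lambda>t. exp (\<i> * of_real (t\<^sup>2)))) \<longlongrightarrow> fresnel_tail x) at_top"
  proof (rule Lim_transform_eventually)
    show "((\<lambda>R. fresnel_tail x - fresnel_tail R) \<longlongrightarrow> fresnel_tail x) at_top"
      using tendsto_diff[OF tendsto_const fresnel_tail_at_top] by simp
    show "\<forall>\<^sub>F R in at_top. fresnel_tail x - fresnel_tail R = integral {x..R} (\<lambda>t. exp (\<i> * of_real (t\<^sup>2)))"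
      using eventually_ge_at_top[of x]
      by eventually_elim (rule integral_unique[OF integral_exp_i_square[OF assms], symmetric])
  qed
  then show ?thesis unfolding fresnel_def by (subst tendsto_Lim) auto
qed

text \<open>The integrand is even, so the integral over \<open>[- x, 0]\<close> is the one over \<open>[0, x]\<close>.\<close>

lemma fresnel_uminus_eq_tail:
  assumes "0 \<le> x"
  shows "fresnel (- x) = exp (- \<i> * of_real pi / 4) / of_real (sqrt pi) * (2 * fresnel_tail 0 - fresnel_tail x)"
proof -
  let ?e = "\<lambda>t::real. exp (\<i> * of_real (t\<^sup>2))"
  have left: "(?e has_integral (fresnel_tail 0 - fresnel_tail x)) {- x..0}"
    using has_integral_reflect_real[where a = "- x" and b = 0 and f = ?e] integral_exp_i_square[of 0 x] assms by simp
  have "((\<lambda>R. integral {- x..R} ?e) \<longlongrightarrow> 2 * fresnel_tail 0 - fresnel_tail x) at_top"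
  proof (rule Lim_transform_eventually)
    show "((\<lambda>R. 2 * fresnel_tail 0 - fresnel_tail x - fresnel_tail R) \<longlongrightarrow> 2 * fresnel_tail 0 - fresnel_tail x) at_top"
      using tendsto_diff[OF tendsto_const fresnel_tail_at_top] by simp
    show "\<forall>\<^sub>F R in at_top. 2 * fresnel_tail 0 - fresnel_tail x - fresnel_tail R = integral {- x..R} ?e"
      using eventually_ge_at_top[of 0]
    proof eventually_elim
      case (elim R)
      then show ?case
        using has_integral_combine[OF _ _ left integral_exp_i_square[of 0 R]] assms
        by (simp add: integral_unique)
    qed
  qed
  then show ?thesis unfolding fresnel_def by (subst tendsto_Lim) auto
qed

section \<open>Monotonicity of the modulus and the bound for negative arguments\<close>

lemma norm_fresnel_prefactor: "norm (exp (- \<i> * of_real pi / 4) / of_real (sqrt pi)) = 1 / sqrt pi"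
proof -
  have "exp (- \<i> * of_real pi / 4) = cis (- pi / 4)" by (simp add: cis_conv_exp)
  then show ?thesis by (simp add: norm_divide)
qed

lemma norm_fresnel_tail_0: "norm (fresnel_tail 0) = sqrt pi / 2"
proof -
  have "(aux_re 0)\<^sup>2 + (aux_im 0)\<^sup>2 = (sqrt pi / 2)\<^sup>2"
    by (simp add: aux_at_0 power_divide power_mult_distrib)
  then show ?thesis unfolding norm_fresnel_tail by (simp only: real_sqrt_abs) simp
qed

text \<open>The coupling terms \<open>\<plusminus> 4 x a b\<close> cancel, so the sign of the derivative is known.\<close>

lemma DERIV_norm_fresnel_tail_square:
  assumes "x > 0"
  shows "DERIV (\<lambda>x. (aux_re x)\<^sup>2 + (aux_im x)\<^sup>2) x :> - 2 * aux_re x"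
  by (auto intro!: derivative_eq_intros DERIV_aux_re DERIV_aux_im assms simp: algebra_simps)

lemma norm_fresnel_tail_le:
  assumes "0 \<le> x"
  shows "norm (fresnel_tail x) \<le> sqrt pi / 2"
proof -
  have "(aux_re x)\<^sup>2 + (aux_im x)\<^sup>2 \<le> (\<lambda>_. (aux_re 0)\<^sup>2 + (aux_im 0)\<^sup>2) x"
    by (rule le_of_DERIV_le[where f = "\<lambda>x. (aux_re x)\<^sup>2 + (aux_im x)\<^sup>2" and f' = "\<lambda>x. - 2 * aux_re x" and g' = "\<lambda>_. 0"])
      (auto intro!: continuous_intros isCont_aux DERIV_norm_fresnel_tail_square[simplified] assms aux_nonneg)
  then show ?thesis
    unfolding norm_fresnel_tail_0[symmetric] unfolding norm_fresnel_tail by simp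
qed

lemma norm_fresnel_nonpos:
  assumes "x \<le> 0"
  shows "norm (fresnel x) \<ge> 1 / 2"
proof -
  have "norm (2 * fresnel_tail 0) - norm (fresnel_tail (- x)) \<le> norm (2 * fresnel_tail 0 - fresnel_tail (- x))"
    by (rule norm_triangle_ineq2)
  then have "sqrt pi / 2 \<le> norm (2 * fresnel_tail 0 - fresnel_tail (- x))"
    using norm_fresnel_tail_le[of "- x"] assms by (simp add: norm_mult norm_fresnel_tail_0)
  moreover have "fresnel x = exp (- \<i> * of_real pi / 4) / of_real (sqrt pi) * (2 * fresnel_tail 0 - fresnel_tail (- x))"
    using fresnel_uminus_eq_tail[of "- x"] assms by simp
  then have "norm (fresnel x) = 1 / sqrt pi * norm (2 * fresnel_tail 0 - fresnel_tail (- x))"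
    by (simp only: norm_mult norm_fresnel_prefactor)
  ultimately have "1 / sqrt pi * (sqrt pi / 2) \<le> norm (fresnel x)"
    by (simp only:) (intro mult_left_mono, auto)
  then show ?thesis by simp
qed

section \<open>The bound for small positive arguments\<close>

text \<open>Successive integration from \<open>0\<close>, where both auxiliary functions equal \<open>c\<close>: nonnegativity bounds
  \<open>b\<close> above and \<open>a\<close> below, the lower bound for \<open>a\<close> sharpens the upper bound for \<open>b\<close>, which gives an
  upper bound for \<open>a\<close>, and this bounds \<open>(a\<^sup>2 + b\<^sup>2)' = - 2 a\<close> from below. Stopping one round earlier
  yields only a cubic, which falls below the required bound before the estimate for large
  arguments takes over.\<close>

lemma norm_fresnel_tail_square_lower_poly:
  fixes x :: real
  defines "c \<equiv> sqrt pi / (2 * sqrt 2)"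
  assumes x: "0 \<le> x"
  shows "(norm (fresnel_tail x))\<^sup>2 \<ge> pi / 4 - 2 * c * x + x\<^sup>2 - 2 / 3 * c * x ^ 3 + c * x ^ 5 / 5 - 4 / 45 * x ^ 6"
proof -
  have 1: "aux_im x \<le> c" if "0 \<le> x" for x
    by (rule le_of_DERIV_le[where f = aux_im and g = "\<lambda>_. c" and f' = "\<lambda>x. - 2 * x * aux_re x" and g' = "\<lambda>_. 0"])
      (auto intro!: continuous_intros isCont_aux DERIV_aux_im[simplified] that simp: c_def aux_at_0 aux_nonneg zero_le_mult_iff)
  have 2: "c - x \<le> aux_re x" if "0 \<le> x" for x
    by (rule le_of_DERIV_le[where f = "\<lambda>x. c - x" and g = aux_re and f' = "\<lambda>_. - 1" and g' = "\<lambda>x. 2 * x * aux_im x - 1"])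
      (auto intro!: continuous_intros isCont_aux DERIV_aux_re that derivative_eq_intros simp: c_def aux_at_0 aux_nonneg zero_le_mult_iff)
  have 3: "aux_im x \<le> c - c * x\<^sup>2 + 2 / 3 * x ^ 3" if "0 \<le> x" for x
  proof (rule le_of_DERIV_le[where g = "\<lambda>x. c - c * x\<^sup>2 + 2 / 3 * x ^ 3" and f' = "\<lambda>x. - 2 * x * aux_re x" and g' = "\<lambda>x. - 2 * x * (c - x)", OF that])
    fix y :: real assume y: "0 < y"
    show "DERIV (\<lambda>x. c - c * x\<^sup>2 + 2 / 3 * x ^ 3) y :> - 2 * y * (c - y)"
      by (auto intro!: derivative_eq_intros simp: algebra_simps power2_eq_square)
    show "- 2 * y * aux_re y \<le> - 2 * y * (c - y)"
      using 2[of y] y by simp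
  qed (auto intro!: continuous_intros isCont_aux DERIV_aux_im[simplified] simp: c_def aux_at_0)
  have 4: "aux_re x \<le> c - x + c * x\<^sup>2 - c / 2 * x ^ 4 + 4 / 15 * x ^ 5" if "0 \<le> x" for x
  proof (rule le_of_DERIV_le[where g = "\<lambda>x. c - x + c * x\<^sup>2 - c / 2 * x ^ 4 + 4 / 15 * x ^ 5" and
        f' = "\<lambda>x. 2 * x * aux_im x - 1" and g' = "\<lambda>x. 2 * x * (c - c * x\<^sup>2 + 2 / 3 * x ^ 3) - 1", OF that])
    fix y :: real assume y: "0 < y"
    show "DERIV (\<lambda>x. c - x + c * x\<^sup>2 - c / 2 * x ^ 4 + 4 / 15 * x ^ 5) y :> 2 * y * (c - c * y\<^sup>2 + 2 / 3 * y ^ 3) - 1"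
      by (auto intro!: derivative_eq_intros simp: algebra_simps eval_nat_numeral)
    show "2 * y * aux_im y - 1 \<le> 2 * y * (c - c * y\<^sup>2 + 2 / 3 * y ^ 3) - 1"
      using 3[of y] y by simp
  qed (auto intro!: continuous_intros isCont_aux DERIV_aux_re simp: c_def aux_at_0)
  let ?P = "\<lambda>x. pi / 4 - 2 * c * x + x\<^sup>2 - 2 / 3 * c * x ^ 3 + c * x ^ 5 / 5 - 4 / 45 * x ^ 6"
  have "?P x \<le> (aux_re x)\<^sup>2 + (aux_im x)\<^sup>2"
  proof (rule le_of_DERIV_le[where f = ?P and f' = "\<lambda>x. - 2 * (c - x + c * x\<^sup>2 - c / 2 * x ^ 4 + 4 / 15 * x ^ 5)" and
        g' = "\<lambda>x. - 2 * aux_re x", OF x])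
    show "?P 0 \<le> (aux_re 0)\<^sup>2 + (aux_im 0)\<^sup>2"
      by (simp add: aux_at_0 power_divide power_mult_distrib)
    fix y :: real assume y: "0 < y"
    show "DERIV ?P y :> - 2 * (c - y + c * y\<^sup>2 - c / 2 * y ^ 4 + 4 / 15 * y ^ 5)"
      by (auto intro!: derivative_eq_intros simp: algebra_simps eval_nat_numeral)
    show "- 2 * (c - y + c * y\<^sup>2 - c / 2 * y ^ 4 + 4 / 15 * y ^ 5) \<le> - 2 * aux_re y"
      using 4[of y] y by simp
  qed (auto intro!: continuous_intros isCont_aux DERIV_norm_fresnel_tail_square[simplified])
  then show ?thesis by (simp add: norm_fresnel_tail)
qed

text \<open>The certificate is the expansion in the Bernstein basis \<open>t\<^sup>i w\<^bsup>5 - i\<^esup>\<close>, \<open>w = 39 - 20 t\<close>, of the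
  interval \<open>[0, 39 / 20]\<close>, scaled to integers by \<open>39\<^sup>5 = 90224199\<close>; all its coefficients are positive.\<close>

lemma quintic_nonneg:
  fixes t :: real
  assumes "0 \<le> t" "t \<le> 39 / 20"
  shows "10990 - 3970 * t - 1870 * t\<^sup>2 + 2130 * t ^ 3 - 869 * t ^ 4 + 37 * t ^ 5 \<ge> 0"
proof -
  define w where "w = 39 - 20 * t"
  have "w \<ge> 0" using assms by (simp add: w_def)
  then have "0 \<le> 10990 * w ^ 5 + 944170 * (t * w ^ 4) + 28729330 * (t\<^sup>2 * w ^ 3) + 463301270 * (t ^ 3 * w\<^sup>2)
      + 3467914571 * (t ^ 4 * w) + 1311518783 * t ^ 5"
    using assms by (intro add_nonneg_nonneg mult_nonneg_nonneg zero_le_power) auto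
  also have "\<dots> = 90224199 * (10990 - 3970 * t - 1870 * t\<^sup>2 + 2130 * t ^ 3 - 869 * t ^ 4 + 37 * t ^ 5)"
    unfolding w_def by (simp add: algebra_simps eval_nat_numeral)
  finally show ?thesis by simp
qed

text \<open>The sextic is the lower bound for \<open>4 / \<pi> * |G|\<^sup>2\<close> in the variable \<open>t = sqrt \<pi> x\<close>, with its
  coefficients rounded downwards. After multiplication by \<open>(1 + t)\<^sup>2\<close> and subtraction of \<open>1\<close> a factor
  \<open>t\<close> splits off, reflecting equality at \<open>0\<close>; the terms of degree 5 to 7 in the cofactor are then
  bounded below by a multiple of \<open>t\<^sup>5\<close>, which leaves the quintic above.\<close>

lemma taylor_lower_bound_ge:
  fixes t :: real
  assumes "0 \<le> t" "t \<le> 39 / 20"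
  shows "1 / (1 + t)\<^sup>2 \<le> 1 - 901 / 1000 * t + 405 / 1000 * t\<^sup>2 - 960 / 10000 * t ^ 3 + 91 / 10000 * t ^ 5 - 37 / 10000 * t ^ 6"
    (is "_ \<le> ?Q")
proof -
  have "t * t \<le> 39 / 20 * t" using assms by (intro mult_right_mono) auto
  then have "0 \<le> 145 + 17 * t - 37 * t\<^sup>2 - 37" using assms by (simp add: power2_eq_square)
  then have "0 \<le> t ^ 5 * (145 + 17 * t - 37 * t\<^sup>2 - 37)" using assms by simp
  then have "0 \<le> 10990 - 3970 * t - 1870 * t\<^sup>2 + 2130 * t ^ 3 - 869 * t ^ 4 + 145 * t ^ 5 + 17 * t ^ 6 - 37 * t ^ 7"
    using quintic_nonneg[OF assms] by (simp add: algebra_simps eval_nat_numeral)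
  then have "0 \<le> t * (10990 - 3970 * t - 1870 * t\<^sup>2 + 2130 * t ^ 3 - 869 * t ^ 4 + 145 * t ^ 5 + 17 * t ^ 6 - 37 * t ^ 7) / 10000"
    using assms by simp
  also have "\<dots> = ?Q * (1 + t)\<^sup>2 - 1"
    by (simp add: field_simps eval_nat_numeral)
  finally show ?thesis using assms by (simp add: pos_divide_le_eq add_nonneg_pos)
qed


lemma norm_fresnel_tail_ge_small:
  assumes x: "0 \<le> x" and small: "sqrt pi * x \<le> 39 / 20"
  shows "norm (fresnel_tail x) \<ge> sqrt pi / (2 + 2 * sqrt pi * x)"
proof -
  define t where "t = sqrt pi * x"
  define r where "r = 1 / sqrt (2::real)"
  define p where "p = 1 / pi"
  have t: "0 \<le> t" "t \<le> 39 / 20" using x small by (auto simp: t_def)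
  have "1 / sqrt 2 = sqrt 2 / (2::real)" by (simp add: field_simps)
  moreover have "14142 / 10000 \<le> sqrt (2::real)"
    by (rule real_le_rsqrt) (simp add: power2_eq_square)
  moreover have "sqrt (2::real) \<le> 14143 / 10000"
    by (rule real_le_lsqrt) (simp_all add: power2_eq_square)
  ultimately have r: "7071 / 10000 \<le> r" "r \<le> 70715 / 100000" by (simp_all add: r_def)
  have p: "31830 / 100000 \<le> p" "p \<le> 31831 / 100000"
    using pi_approx by (simp_all add: p_def field_simps)
  have p2: "10131 / 100000 \<le> p\<^sup>2" "p\<^sup>2 \<le> 10133 / 100000"
    using power_mono[OF p(1), of 2] power_mono[OF p(2), of 2] p by (auto simp: power2_eq_square)
  have p3: "3224 / 100000 \<le> p ^ 3"
    using power_mono[OF p(1), of 3] by (auto simp: power3_eq_cube)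
  have p4: "p ^ 4 \<le> 1027 / 100000"
    using power_mono[OF p(2), of 4] p by (auto simp: eval_nat_numeral)
  \<comment> \<open>In the variable \<open>t\<close> the coefficients of the polynomial bound are monomials in \<open>1 / sqrt 2\<close> and
    \<open>1 / \<pi>\<close>; each is rounded in the unfavourable direction.\<close>
  have "4 * (r * p) \<le> 901 / 1000"
    using mult_mono[OF r(2) p(2)] r p by simp
  moreover have "405 / 1000 \<le> 4 * p\<^sup>2" using p2 by simp
  moreover have "4 / 3 * (r * p\<^sup>2) \<le> 960 / 10000"
    using mult_mono[OF r(2) p2(2)] r by simp
  moreover have "91 / 10000 \<le> 2 / 5 * (r * p ^ 3)"
    using mult_mono[OF r(1) p3] r by simp
  moreover have "16 / 45 * p ^ 4 \<le> 37 / 10000" using p4 by simp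
  ultimately have "1 - 901 / 1000 * t + 405 / 1000 * t\<^sup>2 - 960 / 10000 * t ^ 3 + 91 / 10000 * t ^ 5 - 37 / 10000 * t ^ 6
      \<le> 1 - 4 * (r * p) * t + 4 * p\<^sup>2 * t\<^sup>2 - 4 / 3 * (r * p\<^sup>2) * t ^ 3 + 2 / 5 * (r * p ^ 3) * t ^ 5 - 16 / 45 * p ^ 4 * t ^ 6"
    using t by (intro add_mono diff_mono mult_right_mono) auto
  with taylor_lower_bound_ge[OF t]
  have "pi / 4 * (1 / (1 + t)\<^sup>2) \<le> pi / 4 * (1 - 4 * (r * p) * t + 4 * p\<^sup>2 * t\<^sup>2
      - 4 / 3 * (r * p\<^sup>2) * t ^ 3 + 2 / 5 * (r * p ^ 3) * t ^ 5 - 16 / 45 * p ^ 4 * t ^ 6)"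
    by (intro mult_left_mono) auto
  also have "\<dots> = pi / 4 - 2 * (sqrt pi / (2 * sqrt 2)) * x + x\<^sup>2 - 2 / 3 * (sqrt pi / (2 * sqrt 2)) * x ^ 3
      + (sqrt pi / (2 * sqrt 2)) * x ^ 5 / 5 - 4 / 45 * x ^ 6"
  proof -
    have s: "sqrt pi ^ 2 = pi" "sqrt pi ^ 3 = pi * sqrt pi" "sqrt pi ^ 5 = pi\<^sup>2 * sqrt pi" "sqrt pi ^ 6 = pi ^ 3"
      by (simp_all add: eval_nat_numeral)
    have c: "sqrt pi / (2 * sqrt 2) = r * sqrt pi / 2" by (simp add: r_def)
    show ?thesis
      unfolding c t_def p_def power_mult_distrib s
      by (simp add: field_simps eval_nat_numeral)
  qed
  also have "\<dots> \<le> (norm (fresnel_tail x))\<^sup>2"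
    by (rule norm_fresnel_tail_square_lower_poly[OF x])
  also have "pi / 4 * (1 / (1 + t)\<^sup>2) = (sqrt pi / (2 * (1 + t)))\<^sup>2"
    by (simp add: power2_eq_square field_simps)
  finally have "sqrt pi / (2 * (1 + t)) \<le> norm (fresnel_tail x)"
    by (rule power2_le_imp_le) simp
  then show ?thesis by (simp add: t_def algebra_simps)
qed

section \<open>The bound for large arguments and the theorem\<close>

text \<open>The imaginary part alone suffices when \<open>3 / (2 x\<^sup>3) \<le> 2 / sqrt \<pi>\<close>, that is, when
  \<open>(sqrt \<pi> x)\<^sup>3 \<ge> 3 \<pi>\<^sup>2 / 4\<close>. The right-hand side is slightly below \<open>(39 / 20)\<^sup>3\<close>, which explains the
  choice of the splitting point.\<close>

lemma norm_fresnel_tail_ge_large: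
  assumes large: "39 / 20 \<le> sqrt pi * x"
  shows "norm (fresnel_tail x) \<ge> sqrt pi / (2 + 2 * sqrt pi * x)"
proof -
  have "0 < sqrt pi * x" using large by linarith
  then have x: "0 < x" by (simp add: zero_less_mult_iff)
  have "(39 / 20) ^ 3 \<le> (sqrt pi * x) ^ 3" using large by (intro power_mono) auto
  also have "\<dots> = pi * (sqrt pi * x ^ 3)" by (simp add: power_mult_distrib power3_eq_cube)
  finally have "(39 / 20) ^ 3 \<le> pi * (sqrt pi * x ^ 3)" .
  moreover have "pi * (3 * pi) \<le> 4 * (39 / 20) ^ 3"
    using mult_mono[of pi "31416 / 10000" pi "31416 / 10000"] pi_approx by (simp add: power3_eq_cube)
  ultimately have "pi * (3 * pi) \<le> pi * (4 * (sqrt pi * x ^ 3))" by linarith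
  then have "3 * pi \<le> 4 * (sqrt pi * x ^ 3)" by simp
  also have "3 * pi = sqrt pi * (3 * sqrt pi)" by simp
  finally have "3 * sqrt pi \<le> 4 * x ^ 3" by (simp only: mult.left_commute[of 4] mult_le_cancel_left_pos real_sqrt_gt_zero pi_gt_zero)
  then have "3 / (2 * x ^ 3) \<le> 2 / sqrt pi" using x by (simp add: field_simps)
  then have "1 / (2 * x + 2 / sqrt pi) \<le> 1 / (2 * x + 3 / (2 * x ^ 3))"
    using x by (intro divide_left_mono mult_pos_pos add_pos_pos) auto
  also have "\<dots> \<le> aux_im x" by (rule aux_im_lower[OF x])
  also have "\<dots> \<le> norm (fresnel_tail x)" unfolding norm_fresnel_tail by simp
  also have "1 / (2 * x + 2 / sqrt pi) = sqrt pi / (2 + 2 * sqrt pi * x)"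
    using x by (simp add: field_simps)
  finally show ?thesis .
qed

theorem theorem4:
  "(\<forall>x::real. x \<ge> 0 \<longrightarrow> cmod (fresnel x) \<ge> 1 / (2 + 2 * sqrt pi * x)) \<and>
   (\<forall>x::real. x \<le> 0 \<longrightarrow> cmod (fresnel x) \<ge> 1 / 2)"
proof (intro conjI allI impI)
  fix x :: real assume x: "x \<ge> 0"
  have "1 / (2 + 2 * sqrt pi * x) = 1 / sqrt pi * (sqrt pi / (2 + 2 * sqrt pi * x))" by simp
  also have "\<dots> \<le> 1 / sqrt pi * norm (fresnel_tail x)"
    using norm_fresnel_tail_ge_small[OF x] norm_fresnel_tail_ge_large[of x]
    by (intro mult_left_mono) (linarith, simp)
  also have "\<dots> = norm (fresnel x)"
    unfolding fresnel_eq_tail[OF x] norm_mult norm_fresnel_prefactor ..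
  finally show "1 / (2 + 2 * sqrt pi * x) \<le> norm (fresnel x)" .
qed (rule norm_fresnel_nonpos)

end
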